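(* Let $E$ be a finite-dimensional real vector space, $Q\subset E$ nonempty, convex and compact, and $h:Q\to\mathbb{R}$ concave and differentiable on $Q$, with finite curvature constant $C_{h,Q}$. Let $\bar\alpha\in(0,1)$ and run the Frank-Wolfe method with constant step-sizes $\bar\alpha_i=\bar\alpha$ for all $i\ge1$. Then for all $k\ge1$: $$B_k-h(\lambda_{k+1})\le\left(B_k-h(\lambda_1)\right)(1-\bar\alpha)^k+\tfrac12C_{h,Q}\left[\bar\alpha-\bar\alpha(1-\bar\alpha)^k\right].$$ If moreover $\lambda_1$ and $B_0$ are produced by the pre-start step, then for all $k\ge1$: $$B_k-h(\lambda_{k+1})\le\tfrac12C_{h,Q}\left[(1-\bar\alpha)^{k+1}+\bar\alpha\right].$$
   Context: Notation: $E^*$ is the dual space of $E$, $s^T\lambda$ is the evaluation of $s\in E^*$ at $\lambda\in E$, $\nabla h(\lambda)\in E^*$, and $h^*=\max_{\lambda\in Q}h(\lambda)$. Curvature constant: $C_{h,Q}$ is the minimal $C$ such that $h(\lambda+\alpha(\bar\lambda-\lambda))\ge h(\lambda)+\nabla h(\lambda)^T(\alpha(\bar\lambda-\lambda))-\frac12 C\alpha^2$ for all $\lambda,\bar\lambda\in Q$ and all $\alpha\in[0,1]$ (assumed finite). Frank-Wolfe method: start at $\lambda_1\in Q$ with an upper bound $B_0\ge h^*$ (possibly $+\infty$). At iteration $k\ge1$, choose $\tilde\lambda_k\in\arg\max_{\lambda\in Q}\{h(\lambda_k)+\nabla h(\lambda_k)^T(\lambda-\lambda_k)\}$; set $B^w_k=h(\lambda_k)+\nabla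 h(\lambda_k)^T(\tilde\lambda_k-\lambda_k)$; set $B_k=\min\{B_{k-1},B^w_k,B^o_k\}$; set $\lambda_{k+1}=\lambda_k+\bar\alpha_k(\tilde\lambda_k-\lambda_k)$. Pre-start step (optional way of producing $\lambda_1$ and $B_0$): given $\lambda_0\in Q$ and an upper bound $B_{-1}\ge h^*$ (possibly $+\infty$), choose $\tilde\lambda_0\in\arg\max_{\lambda\in Q}\{h(\lambda_0)+\nabla h(\lambda_0)^T(\lambda-\lambda_0)\}$, set $B^w_0=h(\lambda_0)+\nabla h(\lambda_0)^T(\tilde\lambda_0-\lambda_0)$, $B_0=\min\{B_{-1},B^w_0,B^o_0\}$, and $\lambda_1=\tilde\lambda_0$. Here each $B^o_k\ge h^*$ ($k\ge0$) is any other (optional) upper bound on $h^*$ (omitted, or $+\infty$, if not computed). *)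

theory Defs
  imports "HOL-Analysis.Analysis"
begin

text \<open>
  Throughout, \<open>h\<close> is a total function of which only the values on \<open>Q\<close> matter, and \<open>dh x\<close> is the
  linear functional playing the role of the gradient of \<open>h\<close> at \<open>x\<close>, i.e. a derivative of \<open>h\<close> at \<open>x\<close>
  within \<open>Q\<close>. Such a derivative need not be unique if \<open>Q\<close> is not full-dimensional, but it is always
  applied to multiples of \<open>y - x\<close> with \<open>x, y \<in> Q\<close>, where, for convex \<open>Q\<close>, its value is determined by \<open>h\<close>.
\<close>

definition curvature_bound ::
    "('a::real_normed_vector \<Rightarrow> real) \<Rightarrow> ('a \<Rightarrow> 'a \<Rightarrow> real) \<Rightarrow> 'a set \<Rightarrow> real \<Rightarrow> bool" where
  "curvature_bound h dh Q C \<longleftrightarrow>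
     (\<forall>x\<in>Q. \<forall>y\<in>Q. \<forall>\<alpha>\<in>{0..1}.
        h (x + \<alpha> *\<^sub>R (y - x)) \<ge> h x + dh x (\<alpha> *\<^sub>R (y - x)) - 1/2 * C * \<alpha>\<^sup>2)"

definition curvature_const ::
    "('a::real_normed_vector \<Rightarrow> real) \<Rightarrow> ('a \<Rightarrow> 'a \<Rightarrow> real) \<Rightarrow> 'a set \<Rightarrow> real" where
  "curvature_const h dh Q = (LEAST C. curvature_bound h dh Q C)"

text \<open>The minimum is attained as soon as some bound exists, which is what finiteness of the
  curvature constant means.\<close>

lemma curvature_const_minimal:
  assumes "Q \<noteq> {}" and "\<exists>C. curvature_bound h dh Q C"
  shows "curvature_bound h dh Q (curvature_const h dh Q)"
    and "curvature_bound h dh Q C \<Longrightarrow> curvature_const h dh Q \<le> C"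
proof -
  let ?S = "{C. curvature_bound h dh Q C}"
  obtain q where q: "q \<in> Q" using assms(1) by blast
  have ne: "?S \<noteq> {}" using assms(2) by blast
  have lower: "C \<ge> 2 * (h x + dh x (\<alpha> *\<^sub>R (y - x)) - h (x + \<alpha> *\<^sub>R (y - x))) / \<alpha>\<^sup>2"
    if "C \<in> ?S" "x \<in> Q" "y \<in> Q" "0 < \<alpha>" "\<alpha> \<le> 1" for C x y \<alpha>
  proof -
    have "h (x + \<alpha> *\<^sub>R (y - x)) \<ge> h x + dh x (\<alpha> *\<^sub>R (y - x)) - 1/2 * C * \<alpha>\<^sup>2"
      using that by (simp add: curvature_bound_def)
    then show ?thesis using that(4) by (simp add: pos_divide_le_eq)
  qed
  have bdd: "bdd_below ?S"
    using lower[OF _ q q, of _ 1] by (intro bdd_belowI) auto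
  define I where "I = Inf ?S"
  have "curvature_bound h dh Q I"
    unfolding curvature_bound_def
  proof (intro ballI)
    fix x y and \<alpha> :: real
    assume *: "x \<in> Q" "y \<in> Q" "\<alpha> \<in> {0..1}"
    show "h (x + \<alpha> *\<^sub>R (y - x)) \<ge> h x + dh x (\<alpha> *\<^sub>R (y - x)) - 1/2 * I * \<alpha>\<^sup>2"
    proof (cases "\<alpha> = 0")
      case True
      obtain C where "curvature_bound h dh Q C" using assms(2) by blast
      then show ?thesis using * True unfolding curvature_bound_def by fastforce
    next
      case False
      then have "I \<ge> 2 * (h x + dh x (\<alpha> *\<^sub>R (y - x)) - h (x + \<alpha> *\<^sub>R (y - x))) / \<alpha>\<^sup>2"
        unfolding I_def using * by (intro cInf_greatest[OF ne] lower) auto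
      then show ?thesis using False by (simp add: pos_divide_le_eq)
    qed
  qed
  moreover have low: "I \<le> C" if "curvature_bound h dh Q C" for C
    unfolding I_def using that bdd by (intro cInf_lower) auto
  ultimately have "curvature_const h dh Q = I"
    unfolding curvature_const_def by (intro Least_equality) auto
  with \<open>curvature_bound h dh Q I\<close> low
  show "curvature_bound h dh Q (curvature_const h dh Q)"
    and "curvature_bound h dh Q C \<Longrightarrow> curvature_const h dh Q \<le> C" by simp_all
qed

text \<open>For \<open>h\<close> continuous on a nonempty compact \<open>Q\<close> this supremum is the maximum.\<close>

definition opt_value :: "('a \<Rightarrow> real) \<Rightarrow> 'a set \<Rightarrow> real" where
  "opt_value h Q = (SUP x\<in>Q. h x)"

definition linearization ::
    "('a::real_normed_vector \<Rightarrow> real) \<Rightarrow> ('a \<Rightarrow> 'a \<Rightarrow> real) \<Rightarrow> 'a \<Rightarrow> 'a \<Rightarrow> real" where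
  "linearization h dh x y = h x + dh x (y - x)"

text \<open>
  \<open>lam k\<close> are the iterates, \<open>lamt k\<close> the maximizers of the linearizations, \<open>Bo k\<close> the optional other
  upper bounds (\<open>\<infinity>\<close> if not computed), \<open>B k\<close> the best bounds and \<open>a k\<close> the step-sizes. Index \<open>0\<close> of
  \<open>lam\<close>, \<open>lamt\<close> and \<open>Bo\<close> is left unconstrained here: it is reserved for the pre-start step.
\<close>

definition frank_wolfe ::
    "('a::real_normed_vector \<Rightarrow> real) \<Rightarrow> ('a \<Rightarrow> 'a \<Rightarrow> real) \<Rightarrow> 'a set \<Rightarrow> (nat \<Rightarrow> real) \<Rightarrow>
     (nat \<Rightarrow> 'a) \<Rightarrow> (nat \<Rightarrow> 'a) \<Rightarrow> (nat \<Rightarrow> ereal) \<Rightarrow> (nat \<Rightarrow> ereal) \<Rightarrow> bool" where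
  "frank_wolfe h dh Q a lam lamt Bo B \<longleftrightarrow>
     lam 1 \<in> Q \<and> B 0 \<ge> ereal (opt_value h Q) \<and>
     (\<forall>k\<ge>1.
        is_arg_max (linearization h dh (lam k)) (\<lambda>x. x \<in> Q) (lamt k) \<and>
        Bo k \<ge> ereal (opt_value h Q) \<and>
        B k = min (B (k - 1)) (min (ereal (linearization h dh (lam k) (lamt k))) (Bo k)) \<and>
        lam (k + 1) = lam k + a k *\<^sub>R (lamt k - lam k))"

text \<open>\<open>Binit\<close> is the upper bound with index \<open>-1\<close>.\<close>

definition pre_start ::
    "('a::real_normed_vector \<Rightarrow> real) \<Rightarrow> ('a \<Rightarrow> 'a \<Rightarrow> real) \<Rightarrow> 'a set \<Rightarrow> ereal \<Rightarrow>
     (nat \<Rightarrow> 'a) \<Rightarrow> (nat \<Rightarrow> 'a) \<Rightarrow> (nat \<Rightarrow> ereal) \<Rightarrow> (nat \<Rightarrow> ereal) \<Rightarrow> bool" where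
  "pre_start h dh Q Binit lam lamt Bo B \<longleftrightarrow>
     lam 0 \<in> Q \<and> Binit \<ge> ereal (opt_value h Q) \<and>
     is_arg_max (linearization h dh (lam 0)) (\<lambda>x. x \<in> Q) (lamt 0) \<and>
     Bo 0 \<ge> ereal (opt_value h Q) \<and>
     B 0 = min Binit (min (ereal (linearization h dh (lam 0) (lamt 0))) (Bo 0)) \<and>
     lam 1 = lamt 0"

end

theory Submission
  imports Defs
begin

text \<open>
  The curvature bound turns every step into
  \<open>M - h (lam (j + 1)) \<le> (1 - \<alpha>) * (M - h (lam j)) + C * \<alpha>\<^sup>2 / 2\<close> for each number \<open>M\<close> below the
  \<open>j\<close>-th linearization maximum. The best bound \<open>B k\<close> is such an \<open>M\<close> for all \<open>j \<le> k\<close> at once, so the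
  recursion can be unrolled with \<open>M = B k\<close> fixed. The pre-start step is the same estimate with
  step-size \<open>1\<close>, whence \<open>M - h (lam 1) \<le> C / 2\<close>.
\<close>

text \<open>Linearity moves the factor \<open>\<alpha>\<close> out of \<open>dh x\<close>, so
  \<open>h x + \<alpha> * dh x (y - x)\<close> becomes the convex combination of \<open>h x\<close>
  and the linearization at \<open>y\<close>. In this form a lower bound on the linearization can be
  inserted directly.\<close>

lemma curvature_bound_step:
  assumes "curvature_bound h dh Q C" "x \<in> Q" "y \<in> Q" "linear (dh x)" "0 \<le> \<alpha>" "\<alpha> \<le> 1"
  shows "(1 - \<alpha>) * h x + \<alpha> * linearization h dh x y - 1/2 * C * \<alpha>\<^sup>2 \<le> h (x + \<alpha> *\<^sub>R (y - x))"
proof -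
  have "dh x (\<alpha> *\<^sub>R (y - x)) = \<alpha> * dh x (y - x)"
    using linear_scale[OF assms(4)] by simp
  moreover have "h x + dh x (\<alpha> *\<^sub>R (y - x)) - 1/2 * C * \<alpha>\<^sup>2 \<le> h (x + \<alpha> *\<^sub>R (y - x))"
    using assms by (simp add: curvature_bound_def)
  ultimately show ?thesis
    by (simp add: linearization_def algebra_simps)
qed

text \<open>The number \<open>c * \<alpha>\<close> is a fixed point of the map sending
  \<open>t\<close> to \<open>(1 - \<alpha>) * t + c * \<alpha>\<^sup>2\<close>, and the excess of
  \<open>e\<close> over it shrinks by the factor \<open>1 - \<alpha>\<close> in each step.\<close>

lemma affine_recurrence_bound:
  fixes e :: "nat \<Rightarrow> real"
  assumes "\<alpha> \<le> 1"
    and step: "\<And>j. j < k \<Longrightarrow> e (Suc j) \<le> (1 - \<alpha>) * e j + c * \<alpha>\<^sup>2"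
  shows "e k \<le> e 0 * (1 - \<alpha>) ^ k + c * (\<alpha> - \<alpha> * (1 - \<alpha>) ^ k)"
  using step
proof (induction k)
  case 0
  then show ?case by simp
next
  case (Suc k)
  have "e (Suc k) \<le> (1 - \<alpha>) * e k + c * \<alpha>\<^sup>2"
    using Suc.prems by simp
  also have "\<dots> \<le> (1 - \<alpha>) * (e 0 * (1 - \<alpha>) ^ k + c * (\<alpha> - \<alpha> * (1 - \<alpha>) ^ k)) + c * \<alpha>\<^sup>2"
    using Suc assms(1) by (intro add_right_mono mult_left_mono) auto
  also have "\<dots> = e 0 * (1 - \<alpha>) ^ Suc k + c * (\<alpha> - \<alpha> * (1 - \<alpha>) ^ Suc k)"
    by (simp add: algebra_simps power2_eq_square)
  finally show ?case .
qed

lemma frank_wolfe_lamt_mem: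
  assumes "frank_wolfe h dh Q a lam lamt Bo B" "k \<ge> 1"
  shows "lamt k \<in> Q"
  using assms by (simp add: frank_wolfe_def is_arg_max_def)

lemma frank_wolfe_lam_Suc:
  assumes "frank_wolfe h dh Q a lam lamt Bo B" "k \<ge> 1"
  shows "lam (Suc k) = lam k + a k *\<^sub>R (lamt k - lam k)"
  using assms by (simp add: frank_wolfe_def)

text \<open>Every new iterate is a convex combination of two points of \<open>Q\<close>. The
  induction starts at 1 because \<open>frank_wolfe\<close> says nothing about
  \<open>lam 0\<close>.\<close>

lemma frank_wolfe_lam_mem:
  assumes fw: "frank_wolfe h dh Q a lam lamt Bo B" and "convex Q"
    and a: "\<And>i. i \<ge> 1 \<Longrightarrow> 0 \<le> a i \<and> a i \<le> 1" and "k \<ge> 1"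
  shows "lam k \<in> Q"
  using \<open>k \<ge> 1\<close>
proof (induction k rule: dec_induct)
  case base
  then show ?case using fw by (simp add: frank_wolfe_def)
next
  case (step k)
  have "lam (Suc k) = (1 - a k) *\<^sub>R lam k + a k *\<^sub>R lamt k"
    using frank_wolfe_lam_Suc[OF fw] step.hyps by (simp add: algebra_simps)
  also have "\<dots> \<in> Q"
    using step frank_wolfe_lamt_mem[OF fw] a by (intro convexD[OF \<open>convex Q\<close>]) auto
  finally show ?case .
qed

lemma frank_wolfe_B_antimono:
  assumes "frank_wolfe h dh Q a lam lamt Bo B" "j \<le> k"
  shows "B k \<le> B j"
  using assms(2)
proof (rule lift_Suc_antimono_le[rotated])
  show "B (Suc n) \<le> B n" for n
    using assms(1) by (simp add: frank_wolfe_def)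
qed

lemma frank_wolfe_B_le_linearization:
  assumes "frank_wolfe h dh Q a lam lamt Bo B" "1 \<le> j" "j \<le> k"
  shows "B k \<le> ereal (linearization h dh (lam j) (lamt j))"
proof -
  have "B j \<le> ereal (linearization h dh (lam j) (lamt j))"
    using assms by (simp add: frank_wolfe_def min_le_iff_disj)
  with frank_wolfe_B_antimono[OF assms(1,3)] show ?thesis by (rule order_trans)
qed

lemma frank_wolfe_gap_le:
  assumes fw: "frank_wolfe h dh Q a lam lamt Bo B" and "convex Q"
    and lin: "\<And>x. x \<in> Q \<Longrightarrow> linear (dh x)"
    and C: "curvature_bound h dh Q C"
    and \<alpha>: "0 \<le> \<alpha>" "\<alpha> \<le> 1" and a: "\<And>i. i \<ge> 1 \<Longrightarrow> a i = \<alpha>"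
    and M: "ereal M \<le> B k"
  shows "M - h (lam (Suc k))
           \<le> (M - h (lam 1)) * (1 - \<alpha>) ^ k + 1/2 * C * (\<alpha> - \<alpha> * (1 - \<alpha>) ^ k)"
proof -
  have step: "M - h (lam (Suc (Suc j))) \<le> (1 - \<alpha>) * (M - h (lam (Suc j))) + 1/2 * C * \<alpha>\<^sup>2"
    if "j < k" for j
  proof -
    let ?x = "lam (Suc j)" and ?y = "lamt (Suc j)"
    have x: "?x \<in> Q"
      using a \<alpha> by (intro frank_wolfe_lam_mem[OF fw \<open>convex Q\<close>]) auto
    have y: "?y \<in> Q"
      by (intro frank_wolfe_lamt_mem[OF fw]) simp
    \<comment> \<open>Here \<open>j < k\<close> gives \<open>Suc j \<le> k\<close>, so
      \<open>B k\<close> already accounts for the linearization bound of this step.\<close>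
    have "M \<le> linearization h dh ?x ?y"
      using order_trans[OF M frank_wolfe_B_le_linearization[OF fw]] that by simp
    then have "\<alpha> * M \<le> \<alpha> * linearization h dh ?x ?y"
      using \<alpha> by (intro mult_left_mono)
    moreover have "(1 - \<alpha>) * h ?x + \<alpha> * linearization h dh ?x ?y - 1/2 * C * \<alpha>\<^sup>2
                     \<le> h (lam (Suc (Suc j)))"
      using curvature_bound_step[where \<alpha> = \<alpha>, OF C x y lin[OF x]] \<alpha> a
        frank_wolfe_lam_Suc[OF fw, of "Suc j"] by simp
    ultimately show ?thesis by (simp add: algebra_simps)
  qed
  \<comment> \<open>The index is shifted by one: the recurrence starts at 0, the iterates at
    \<open>lam 1\<close>.\<close>
  show ?thesis
    using affine_recurrence_bound[of \<alpha> k "\<lambda>j. M - h (lam (Suc j))" "1/2 * C", OF \<alpha>(2) step]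
    by simp
qed

text \<open>For step-size 1 the weight \<open>1 - \<alpha>\<close> of \<open>h (lam 0)\<close>
  vanishes, so the bound is independent of the starting value.\<close>

lemma pre_start_gap_le:
  assumes ps: "pre_start h dh Q Binit lam lamt Bo B"
    and lin: "\<And>x. x \<in> Q \<Longrightarrow> linear (dh x)"
    and C: "curvature_bound h dh Q C"
    and M: "ereal M \<le> B 0"
  shows "M - h (lam 1) \<le> 1/2 * C"
proof -
  have mem: "lam 0 \<in> Q" "lamt 0 \<in> Q" and lam1: "lam 1 = lamt 0"
    using ps by (auto simp: pre_start_def is_arg_max_def)
  have "M \<le> linearization h dh (lam 0) (lamt 0)"
    using ps M by (simp add: pre_start_def)
  moreover have "linearization h dh (lam 0) (lamt 0) - 1/2 * C \<le> h (lam 1)"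
    using curvature_bound_step[where \<alpha> = 1, OF C mem lin[OF mem(1)]] lam1 by simp
  ultimately show ?thesis by simp
qed

theorem mainTheorem5:
  fixes Q :: "'a::real_normed_vector set"
    and h :: "'a \<Rightarrow> real" and dh :: "'a \<Rightarrow> 'a \<Rightarrow> real"
    and \<alpha> :: real and a :: "nat \<Rightarrow> real"
    and lam lamt :: "nat \<Rightarrow> 'a" and Bo B :: "nat \<Rightarrow> ereal"
  assumes finite_dim: "\<exists>S :: 'a set. finite S \<and> span S = UNIV"
    and Q: "Q \<noteq> {}" "convex Q" "compact Q"
    and concave: "concave_on Q h"
    and deriv: "\<And>x. x \<in> Q \<Longrightarrow> (h has_derivative dh x) (at x within Q)"
    and curvature_finite: "\<exists>C. curvature_bound h dh Q C"
    and \<alpha>: "0 < \<alpha>" "\<alpha> < 1"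
    and fw: "frank_wolfe h dh Q a lam lamt Bo B"
    and const_step: "\<And>i. i \<ge> 1 \<Longrightarrow> a i = \<alpha>"
  shows "(\<forall>k\<ge>1. B k - ereal (h (lam (k + 1)))
            \<le> (B k - ereal (h (lam 1))) * ereal ((1 - \<alpha>) ^ k)
              + ereal (1/2 * curvature_const h dh Q * (\<alpha> - \<alpha> * (1 - \<alpha>) ^ k)))
       \<and> ((\<exists>Binit. pre_start h dh Q Binit lam lamt Bo B) \<longrightarrow>
          (\<forall>k\<ge>1. B k - ereal (h (lam (k + 1)))
            \<le> ereal (1/2 * curvature_const h dh Q * ((1 - \<alpha>) ^ (k + 1) + \<alpha>))))"
proof -
  let ?C = "curvature_const h dh Q"
  have C: "curvature_bound h dh Q ?C"
    using curvature_const_minimal(1)[OF Q(1) curvature_finite] .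
  have lin: "linear (dh x)" if "x \<in> Q" for x
    using deriv[OF that] by (rule has_derivative_linear)
  have gap: "M - h (lam (k + 1))
      \<le> (M - h (lam 1)) * (1 - \<alpha>) ^ k + 1/2 * ?C * (\<alpha> - \<alpha> * (1 - \<alpha>) ^ k)"
    if "B k = ereal M" for k M
    using frank_wolfe_gap_le[OF fw Q(2) lin C _ _ const_step, of M k] \<alpha> that by simp
  \<comment> \<open>Even if \<open>B 0\<close> is infinite, the real linearization maximum keeps
    \<open>B k\<close> below \<open>\<infinity>\<close> from \<open>k = 1\<close> on. In the case
    \<open>-\<infinity>\<close> the left-hand sides are \<open>-\<infinity>\<close> and both claims
    are trivial; otherwise real arithmetic suffices.\<close>
  have finite: "B k = -\<infinity> \<or> (\<exists>M. B k = ereal M)" if "k \<ge> 1" for k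
    using frank_wolfe_B_le_linearization[OF fw that order_refl] by (cases "B k") auto
  have "B k - ereal (h (lam (k + 1)))
          \<le> (B k - ereal (h (lam 1))) * ereal ((1 - \<alpha>) ^ k)
            + ereal (1/2 * ?C * (\<alpha> - \<alpha> * (1 - \<alpha>) ^ k))" if "k \<ge> 1" for k
    using finite[OF that] gap[of k] by auto
  moreover have "B k - ereal (h (lam (k + 1))) \<le> ereal (1/2 * ?C * ((1 - \<alpha>) ^ (k + 1) + \<alpha>))"
    if ps: "pre_start h dh Q Binit lam lamt Bo B" and "k \<ge> 1" for Binit k
    using finite[OF \<open>k \<ge> 1\<close>]
  proof (elim disjE exE)
    fix M assume M: "B k = ereal M"
    \<comment> \<open>The pre-start estimate applies to \<open>M\<close> because
      \<open>B k \<le> B 0\<close>.\<close>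
    have "M - h (lam 1) \<le> 1/2 * ?C"
      using pre_start_gap_le[OF ps lin C, of M] frank_wolfe_B_antimono[OF fw, of 0 k] M by simp
    then have "(M - h (lam 1)) * (1 - \<alpha>) ^ k \<le> 1/2 * ?C * (1 - \<alpha>) ^ k"
      using \<alpha> by (intro mult_right_mono) auto
    \<comment> \<open>The two terms with \<open>(1 - \<alpha>) ^ k\<close> have coefficients 1 and
      \<open>- \<alpha>\<close>, which combine to the power \<open>k + 1\<close>.\<close>
    with gap[OF M] have "M - h (lam (k + 1)) \<le> 1/2 * ?C * ((1 - \<alpha>) ^ (k + 1) + \<alpha>)"
      by (simp add: algebra_simps)
    then show ?thesis using M by simp
  qed simp
  ultimately show ?thesis by blast
qed

end
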